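(* Let $s,N\ge1$, let $A=e_0-q\in\mathfrak A_{s,N}$ be invertible in $\mathfrak A_{s,N}$ (for instance with $q(0)=O_s$), set $\psi=A^{(-1)}$, and let $\widetilde\psi\in\mathfrak A_{s,N}$ (a computed inverse). Define the two residuals $$\rho_L:=e_0-A*\widetilde\psi,\qquad \rho_R:=e_0-\widetilde\psi*A.$$ If either $\|\rho_L\|_{1,N}<1$ or $\|\rho_R\|_{1,N}<1$, then the corresponding residual gives the a posteriori estimate $$\|\psi-\widetilde\psi\|_{1,N}\le\frac{\|\rho\|_{1,N}}{1-\|\rho\|_{1,N}}\,\|\widetilde\psi\|_{1,N},$$ where $\rho\in\{\rho_L,\rho_R\}$ is the residual satisfying the stated condition.
   Context: $\mathfrak A_{s,N}=\mathbb C^{s\times s}[x]/\langle x^N\rangle$ is the ring of truncated matrix polynomials; its elements are identified with finite sequences $(A(0),\ldots,A(N-1))$ of $s\times s$ complex matrices. The product is $(A*B)(k)=\sum_{\ell=0}^kA(\ell)B(k-\ell)$ for $0\le k\le N-1$, truncated after coefficient $N-1$. $e_0$ is the identity: $e_0(0)=I_s$, $e_0(k)=O_s$ (zero matrix) for $k\ge1$. $A^{(-1)}$ is the two-sided inverse in $\mathfrak A_{s,N}$. The norm is $\|A\|_{1,N}=\sum_{k=0}^{N-1}\|A(k)\|_2$, with $\|\cdot\|_2$ the spectral norm. *)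

theory Defs
  imports "HOL-Analysis.Analysis" "HOL-Algebra.Ring"
begin

text \<open>
  The ring of polynomials with \<open>s \<times> s\<close> complex matrix coefficients modulo \<open>x ^ N\<close>,
  where \<open>s = CARD('s)\<close>.  The sequence \<open>(A(0), \<dots>, A(N - 1))\<close> is represented by the
  function on all natural numbers that is extended by zero from index \<open>N\<close> on.
\<close>

definition trunc_mat_poly_ring :: "nat \<Rightarrow> (nat \<Rightarrow> complex ^ 's ^ 's) ring"
  where "trunc_mat_poly_ring N =
    \<lparr>carrier = {A. \<forall>k\<ge>N. A k = 0},
     monoid.mult = (\<lambda>A B k. if k < N then \<Sum>l\<le>k. A l ** B (k - l) else 0),
     one = (\<lambda>k. if k = 0 then mat 1 else 0),
     zero = (\<lambda>k. 0),
     add = (\<lambda>A B k. A k + B k)\<rparr>"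

text \<open>
  The instance of \<^const>\<open>norm\<close> on matrices is the Frobenius norm; the spectral norm is the
  operator norm induced by the Euclidean norm.
\<close>

definition spectral_norm :: "complex ^ 'n ^ 'm \<Rightarrow> real"
  where "spectral_norm M = onorm (\<lambda>v. M *v v)"

definition norm_1N :: "nat \<Rightarrow> (nat \<Rightarrow> complex ^ 's ^ 's) \<Rightarrow> real"
  where "norm_1N N A = (\<Sum>k<N. spectral_norm (A k))"

lemma trunc_mat_poly_ring_simps:
  "A \<in> carrier (trunc_mat_poly_ring N) \<longleftrightarrow> (\<forall>k\<ge>N. A k = 0)"
  "(A \<otimes>\<^bsub>trunc_mat_poly_ring N\<^esub> B) k = (if k < N then \<Sum>l\<le>k. A l ** B (k - l) else 0)"
  "\<one>\<^bsub>trunc_mat_poly_ring N\<^esub> k = (if k = 0 then mat 1 else 0)"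
  "\<zero>\<^bsub>trunc_mat_poly_ring N\<^esub> k = 0"
  "(A \<oplus>\<^bsub>trunc_mat_poly_ring N\<^esub> B) k = A k + B k"
  by (simp_all add: trunc_mat_poly_ring_def)

lemma matrix_add_rdistrib: "(B + C) ** A = B ** A + C ** (A :: complex ^ 'p ^ 's)"
  by (vector matrix_matrix_mult_def sum.distrib[symmetric] field_simps)

lemma matrix_mul_sum_left:
  fixes f :: "'i \<Rightarrow> complex ^ 's ^ 's"
  shows "(\<Sum>i\<in>I. f i) ** B = (\<Sum>i\<in>I. f i ** B)"
  by (induction I rule: infinite_finite_induct) (simp_all add: matrix_add_rdistrib)

lemma matrix_mul_sum_right:
  fixes f :: "'i \<Rightarrow> complex ^ 's ^ 's"
  shows "B ** (\<Sum>i\<in>I. f i) = (\<Sum>i\<in>I. B ** f i)"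
  by (induction I rule: infinite_finite_induct) (simp_all add: matrix_add_ldistrib)

lemma ring_trunc_mat_poly_ring:
  assumes "N \<ge> 1"
  shows "ring (trunc_mat_poly_ring N :: (nat \<Rightarrow> complex ^ 's ^ 's) ring)" (is "ring ?R")
proof (rule ringI)
  show "abelian_group ?R"
  proof (rule abelian_groupI)
    fix A assume "A \<in> carrier ?R"
    then show "\<exists>B\<in>carrier ?R. B \<oplus>\<^bsub>?R\<^esub> A = \<zero>\<^bsub>?R\<^esub>"
      by (intro bexI[of _ "\<lambda>k. - A k"]) (auto simp: trunc_mat_poly_ring_simps fun_eq_iff)
  qed (auto simp: trunc_mat_poly_ring_simps fun_eq_iff)
  show "monoid ?R"
  proof (rule monoidI)
    fix A B C :: "nat \<Rightarrow> complex ^ 's ^ 's"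
    show "A \<otimes>\<^bsub>?R\<^esub> B \<otimes>\<^bsub>?R\<^esub> C = A \<otimes>\<^bsub>?R\<^esub> (B \<otimes>\<^bsub>?R\<^esub> C)"
    proof
      fix k
      have "(\<Sum>l\<le>k. \<Sum>i\<le>l. A i ** B (l - i) ** C (k - l)) =
          (\<Sum>i\<le>k. \<Sum>j\<le>k - i. A i ** B j ** C (k - i - j))"
        by (subst sum.Sigma, simp, simp, subst sum.Sigma, simp, simp)
          (rule sum.reindex_bij_witness
            [of _ "\<lambda>(i, j). (i + j, i)" "\<lambda>(l, i). (i, l - i)"], auto)
      moreover have "k < N \<Longrightarrow> k - i < N" for i
        by simp
      ultimately show "(A \<otimes>\<^bsub>?R\<^esub> B \<otimes>\<^bsub>?R\<^esub> C) k = (A \<otimes>\<^bsub>?R\<^esub> (B \<otimes>\<^bsub>?R\<^esub> C)) k"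
        by (auto simp: trunc_mat_poly_ring_simps matrix_mul_sum_left matrix_mul_sum_right
            matrix_mul_assoc)
    qed
  next
    fix A assume "A \<in> carrier ?R"
    have "(\<Sum>l\<le>k. (if l = 0 then mat 1 else 0) ** A (k - l)) = A k" for k
      by (subst sum.mono_neutral_right[of _ "{0}"]) auto
    with \<open>A \<in> carrier ?R\<close> show "\<one>\<^bsub>?R\<^esub> \<otimes>\<^bsub>?R\<^esub> A = A"
      by (auto simp: trunc_mat_poly_ring_simps fun_eq_iff)
    have "(\<Sum>l\<le>k. A l ** (if k - l = 0 then mat 1 else 0)) = A k" for k
      by (subst sum.mono_neutral_right[of _ "{k}"]) auto
    with \<open>A \<in> carrier ?R\<close> show "A \<otimes>\<^bsub>?R\<^esub> \<one>\<^bsub>?R\<^esub> = A"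
      by (auto simp: trunc_mat_poly_ring_simps fun_eq_iff)
  qed (use assms in \<open>auto simp: trunc_mat_poly_ring_simps\<close>)
qed (auto simp: trunc_mat_poly_ring_simps fun_eq_iff matrix_add_ldistrib
    matrix_add_rdistrib sum.distrib)

end

theory Submission
  imports Defs
begin

text \<open>
  With the error \<open>d = \<psi> - \<psi>'\<close> one has \<open>d = \<psi> * \<rho>\<^sub>L = \<rho>\<^sub>R * \<psi>\<close>, and \<open>\<psi> = \<psi>' + d\<close>.  Since the
  norm is submultiplicative, \<open>norm d \<le> (norm \<psi>' + norm d) * norm \<rho>\<close>, which is solved for \<open>norm d\<close>.
\<close>

lemma bounded_linear_matrix_vector_mult_complex:
  "bounded_linear (\<lambda>v. (M :: complex ^ 'n ^ 'm) *v v)"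
  by (rule matrix_vector_mul_bounded_linear)

lemma spectral_norm_nonneg: "0 \<le> spectral_norm M"
  unfolding spectral_norm_def
  by (rule onorm_pos_le[OF bounded_linear_matrix_vector_mult_complex])

lemma spectral_norm_zero: "spectral_norm 0 = 0"
  by (simp add: spectral_norm_def onorm_zero)

lemma spectral_norm_add_le: "spectral_norm (M + M') \<le> spectral_norm M + spectral_norm M'"
  using onorm_triangle[OF bounded_linear_matrix_vector_mult_complex[of M]
      bounded_linear_matrix_vector_mult_complex[of M']]
  by (simp add: spectral_norm_def matrix_vector_mult_add_rdistrib)

text \<open>The matrix product acts on vectors as the composition of the two linear maps, and
  operator norms are submultiplicative under composition.\<close>

lemma spectral_norm_mult_le: "spectral_norm (M ** M') \<le> spectral_norm M * spectral_norm M'"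
  using onorm_compose[OF bounded_linear_matrix_vector_mult_complex[of M]
      bounded_linear_matrix_vector_mult_complex[of M']]
  by (simp add: spectral_norm_def comp_def matrix_vector_mul_assoc)

lemma spectral_norm_sum_le: "spectral_norm (sum f I) \<le> (\<Sum>i\<in>I. spectral_norm (f i))"
proof (induction I rule: infinite_finite_induct)
  case (insert i I)
  then show ?case
    using spectral_norm_add_le[of "f i" "sum f I"] by simp
qed (simp_all add: spectral_norm_zero)

lemma norm_1N_nonneg: "0 \<le> norm_1N N A"
  by (simp add: norm_1N_def sum_nonneg spectral_norm_nonneg)

lemma norm_1N_add_le:
  "norm_1N N (A \<oplus>\<^bsub>trunc_mat_poly_ring N\<^esub> B) \<le> norm_1N N A + norm_1N N B"
  by (simp add: norm_1N_def trunc_mat_poly_ring_simps sum_mono spectral_norm_add_le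
      flip: sum.distrib)

text \<open>Multiplying out the two norms gives all products with both indices below
  \<open>N\<close>; the truncated convolution only involves those with
  \<open>i + j < N\<close>.\<close>

lemma norm_1N_mult_le:
  "norm_1N N (A \<otimes>\<^bsub>trunc_mat_poly_ring N\<^esub> B) \<le> norm_1N N A * norm_1N N B"
proof -
  define a where "a l = spectral_norm (A l)" for l
  define b where "b l = spectral_norm (B l)" for l
  have "norm_1N N (A \<otimes>\<^bsub>trunc_mat_poly_ring N\<^esub> B) \<le> (\<Sum>k<N. \<Sum>l\<le>k. a l * b (k - l))"
    unfolding norm_1N_def a_def b_def
    by (intro sum_mono)
      (auto simp: trunc_mat_poly_ring_simps
        intro!: order_trans[OF spectral_norm_sum_le] sum_mono spectral_norm_mult_le)
  also have "\<dots> = (\<Sum>(i, j)\<in>{(i, j). i + j < N}. a i * b j)"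
    by (rule sum.triangle_reindex[symmetric])
  \<comment> \<open>The triangle lies inside the square, and the terms gained are
    nonnegative.\<close>
  also have "\<dots> \<le> (\<Sum>(i, j)\<in>{..<N} \<times> {..<N}. a i * b j)"
    by (rule sum_mono2) (auto simp: a_def b_def spectral_norm_nonneg)
  also have "\<dots> = norm_1N N A * norm_1N N B"
    by (simp add: norm_1N_def a_def b_def sum_product sum.cartesian_product)
  finally show ?thesis .
qed

text \<open>Distributing \<open>inv A\<close> over the residual leaves \<open>inv A\<close> minus a
  product in which \<open>inv A\<close> cancels against \<open>A\<close>. The left residual needs
  \<open>inv A\<close> as a left inverse, the right one as a right inverse; nothing specific to
  truncated polynomials enters.\<close>

lemma (in ring) inverse_error_eq_mult_residual:
  assumes "A \<in> Units R" and "B \<in> carrier R"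
  shows "inv A \<ominus> B = inv A \<otimes> (\<one> \<ominus> A \<otimes> B)"
    and "inv A \<ominus> B = (\<one> \<ominus> B \<otimes> A) \<otimes> inv A"
proof -
  have closed: "A \<in> carrier R" "inv A \<in> carrier R"
    using assms by auto
  have "inv A \<otimes> (A \<otimes> B) = B"
    using assms closed by (simp flip: m_assoc)
  then show "inv A \<ominus> B = inv A \<otimes> (\<one> \<ominus> A \<otimes> B)"
    using assms closed by (simp add: a_minus_def r_distr r_minus)
  have "B \<otimes> A \<otimes> inv A = B"
    using assms closed by (simp add: m_assoc)
  then show "inv A \<ominus> B = (\<one> \<ominus> B \<otimes> A) \<otimes> inv A"
    using assms closed by (simp add: a_minus_def l_distr l_minus)
qed

theorem proposition2p6:
  fixes N :: nat
    and A q \<psi> \<psi>' \<rho>L \<rho>R :: "nat \<Rightarrow> complex ^ 's ^ 's"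
    and R :: "(nat \<Rightarrow> complex ^ 's ^ 's) ring" (structure)
  assumes "N \<ge> 1"
    and "R = trunc_mat_poly_ring N"
    and "q \<in> carrier R"
    and "A = \<one> \<ominus> q"
    and "A \<in> Units R"
    and "\<psi> = inv A"
    and "\<psi>' \<in> carrier R"
    and "\<rho>L = \<one> \<ominus> A \<otimes> \<psi>'"
    and "\<rho>R = \<one> \<ominus> \<psi>' \<otimes> A"
  shows "(norm_1N N \<rho>L < 1 \<longrightarrow>
            norm_1N N (\<psi> \<ominus> \<psi>') \<le> norm_1N N \<rho>L / (1 - norm_1N N \<rho>L) * norm_1N N \<psi>')
       \<and> (norm_1N N \<rho>R < 1 \<longrightarrow>
            norm_1N N (\<psi> \<ominus> \<psi>') \<le> norm_1N N \<rho>R / (1 - norm_1N N \<rho>R) * norm_1N N \<psi>')"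
proof -
  interpret ring R
    using ring_trunc_mat_poly_ring[OF assms(1)] assms(2) by simp
  have closed: "\<psi> \<in> carrier R"
    using assms(5,6) by simp
  define d where "d = \<psi> \<ominus> \<psi>'"
  \<comment> \<open>This trades the exact inverse for the computed one, so that the final bound no
    longer involves \<open>\<psi>\<close>.\<close>
  have "d \<oplus> \<psi>' = \<psi>"
    using closed assms(7) by (simp add: d_def a_minus_def a_assoc l_neg)
  then have \<psi>_le: "norm_1N N \<psi> \<le> norm_1N N d + norm_1N N \<psi>'"
    using norm_1N_add_le[of N d \<psi>'] assms(2) by simp
  \<comment> \<open>Kept generic in \<open>\<rho>\<close> to serve both residuals.\<close>
  have bound: "norm_1N N d \<le> norm_1N N \<rho> / (1 - norm_1N N \<rho>) * norm_1N N \<psi>'"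
    if "norm_1N N d \<le> norm_1N N \<psi> * norm_1N N \<rho>" "norm_1N N \<rho> < 1" for \<rho>
  proof -
    have "norm_1N N d \<le> (norm_1N N d + norm_1N N \<psi>') * norm_1N N \<rho>"
      using that(1) mult_right_mono[OF \<psi>_le norm_1N_nonneg] by (rule order_trans)
    \<comment> \<open>Collecting the terms in \<open>norm_1N N d\<close> leaves the factor
      \<open>1 - norm_1N N \<rho>\<close>, which is positive, so dividing by it keeps the
      inequality.\<close>
    with that(2) show ?thesis
      by (simp add: pos_le_divide_eq algebra_simps)
  qed
  have "d = \<psi> \<otimes> \<rho>L" "d = \<rho>R \<otimes> \<psi>"
    using inverse_error_eq_mult_residual[OF assms(5,7)] assms(6,8,9) by (simp_all add: d_def)
  \<comment> \<open>The ring factors of \<open>\<rho>R \<otimes> \<psi>\<close> come in the opposite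
    order, but their norms are reals and commute, which yields the form required by
    \<open>bound\<close>.\<close>
  then have "norm_1N N d \<le> norm_1N N \<psi> * norm_1N N \<rho>L" "norm_1N N d \<le> norm_1N N \<psi> * norm_1N N \<rho>R"
    using norm_1N_mult_le[of N \<psi> \<rho>L] norm_1N_mult_le[of N \<rho>R \<psi>] assms(2)
    by (simp_all add: mult.commute)
  then show ?thesis
    unfolding d_def[symmetric] using bound by blast
qed

end
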